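(* $$\lim_{B\to\infty}\frac{\#\mathcal{G}_1(B)}{\#\mathcal{P}(B)}=\frac{1}{3}.$$
   Context: For $B>0$ define the finite sets $$\mathcal{P}(B)=\{(r,s)\in\mathbb{Z}^2:\ \gcd(r,s)=1,\ 0<s<r,\ r\leq B\},$$ $$\mathcal{G}_1(B)=\{(k,m)\in\mathbb{Z}^2:\ \gcd(k,m)=1,\ 0<m<k\leq B,\ k\equiv m\equiv 1 \pmod 2\}.$$ Here $\#$ denotes cardinality. *)

theory Defs
  imports "HOL-Analysis.Analysis" "HOL-Number_Theory.Number_Theory"
begin

text \<open>The bound \<open>B\<close> ranges over the reals; the definitions are total, but only
  \<open>B > 0\<close> is of interest.\<close>

definition P_set :: "real \<Rightarrow> (int \<times> int) set" where
  "P_set B = {(r, s). gcd r s = 1 \<and> 0 < s \<and> s < r \<and> real_of_int r \<le> B}"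

definition G1_set :: "real \<Rightarrow> (int \<times> int) set" where
  "G1_set B = {(k, m). gcd k m = 1 \<and> 0 < m \<and> m < k \<and> real_of_int k \<le> B \<and>
                       [k = m] (mod 2) \<and> [m = 1] (mod 2)}"

text \<open>Both sets are finite, so \<open>card\<close> is the true cardinality.\<close>

lemma finite_P_set: "finite (P_set B)"
proof (rule finite_subset)
  show "P_set B \<subseteq> {0..\<lfloor>B\<rfloor>} \<times> {0..\<lfloor>B\<rfloor>}"
    by (auto simp: P_set_def le_floor_iff)
qed simp

lemma finite_G1_set: "finite (G1_set B)"
  by (rule finite_subset[OF _ finite_P_set[of B]]) (auto simp: G1_set_def P_set_def)

end

theory Submission
  imports Defs "HOL-Real_Asymp.Real_Asymp"
begin

text \<open>
  Let \<open>D(n) = #P(n) - 3 #G1(n)\<close>. It is the sum, over the coprime pairs \<open>s < r \<le> n\<close>, of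
  a weight that depends only on parities: \<open>-2\<close> if both entries are odd, \<open>1\<close> if exactly one is,
  and \<open>0\<close> if both are even, which coprime pairs never are. Without coprimality the three
  non-trivial parity classes are equally frequent, so the weights of all pairs almost cancel: their
  sum \<open>A(n)\<close> is \<open>0\<close> or \<open>n/2\<close> (\<open>sum_parity_defect_pairs_upto\<close>).

  Multiplying both entries by an odd number preserves the weight, and a pair of non-zero weight has an
  odd gcd. Sorting all pairs by their gcd therefore gives \<open>A(n) = \<Sum> D(n div d)\<close> over odd
  \<open>d \<le> n\<close> (\<open>sum_pairs_upto_by_odd_gcd\<close>). Solving for the term \<open>d = 1\<close>, a bound of
  order \<open>n powr (3/2)\<close> for \<open>D\<close> propagates by induction, because \<open>d powr (-3/2)\<close> sums to less
  than \<open>1\<close> over the odd \<open>d \<ge> 3\<close> (\<open>odd_dilation_bound\<close>). This replaces Moebius inversion.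

  The same sorting, with weight \<open>1\<close> on every pair that is not doubly even, shows that \<open>#P(n)\<close>
  has order \<open>n\<^sup>2\<close> (\<open>card_P_set_lower_bound\<close>). Hence \<open>D(n) / #P(n)\<close> tends to \<open>0\<close>, which is the
  claim.
\<close>

section \<open>Sorting integer pairs by an odd gcd\<close>

definition pairs_upto :: "nat \<Rightarrow> (int \<times> int) set" where
  "pairs_upto n = {(r, s). 0 < s \<and> s < r \<and> r \<le> int n}"

definition odds_upto :: "nat \<Rightarrow> nat set" where
  "odds_upto n = {d. odd d \<and> 3 \<le> d \<and> d \<le> n}"

lemma finite_pairs_upto: "finite (pairs_upto n)"
  by (rule finite_subset[of _ "{0..int n} \<times> {0..int n}"]) (auto simp: pairs_upto_def)

lemma finite_odds_upto: "finite (odds_upto n)"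
  by (rule finite_subset[of _ "{..n}"]) (auto simp: odds_upto_def)

lemma P_set_of_nat: "P_set (real n) = {p \<in> pairs_upto n. gcd (fst p) (snd p) = 1}"
  by (auto simp: P_set_def pairs_upto_def)

lemma bij_betw_scale_P_set:
  assumes "0 < d"
  shows "bij_betw (\<lambda>p. (int d * fst p, int d * snd p)) (P_set (real (n div d)))
           {p \<in> pairs_upto n. gcd (fst p) (snd p) = int d}"
proof (rule bij_betw_byWitness[where f' = "\<lambda>p. (fst p div int d, snd p div int d)"])
  show "\<forall>p\<in>P_set (real (n div d)).
          (fst (int d * fst p, int d * snd p) div int d, snd (int d * fst p, int d * snd p) div int d) = p"
    using assms by auto
  show "\<forall>p\<in>{p \<in> pairs_upto n. gcd (fst p) (snd p) = int d}.
          (int d * fst (fst p div int d, snd p div int d),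
           int d * snd (fst p div int d, snd p div int d)) = p"
    by (auto simp: prod_eq_iff) (metis dvd_mult_div_cancel gcd_dvd1, metis dvd_mult_div_cancel gcd_dvd2)
  show "(\<lambda>p. (int d * fst p, int d * snd p)) ` P_set (real (n div d))
          \<subseteq> {p \<in> pairs_upto n. gcd (fst p) (snd p) = int d}"
  proof clarify
    fix r s assume "(r, s) \<in> P_set (real (n div d))"
    then have rs: "gcd r s = 1" "0 < s" "s < r" "r \<le> int (n div d)"
      by (auto simp: P_set_def)
    have "int d * r \<le> int d * int (n div d)"
      using rs assms by simp
    also have "\<dots> \<le> int n"
      by (metis of_nat_le_iff of_nat_mult times_div_less_eq_dividend)
    finally show "(int d * fst (r, s), int d * snd (r, s)) \<in> pairs_upto n \<and>
        gcd (fst (int d * fst (r, s), int d * snd (r, s))) (snd (int d * fst (r, s), int d * snd (r, s))) = int d"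
      using rs assms by (auto simp: pairs_upto_def gcd_mult_distrib_int[symmetric])
  qed
  show "(\<lambda>p. (fst p div int d, snd p div int d)) ` {p \<in> pairs_upto n. gcd (fst p) (snd p) = int d}
          \<subseteq> P_set (real (n div d))"
  proof clarify
    fix r s assume "(r, s) \<in> pairs_upto n" and g: "gcd (fst (r, s)) (snd (r, s)) = int d"
    then have rs: "0 < s" "s < r" "r \<le> int n" by (auto simp: pairs_upto_def)
    obtain r' s' where eq: "r = int d * r'" "s = int d * s'"
      using g by (metis dvdE fst_conv gcd_dvd1 gcd_dvd2 snd_conv)
    have "gcd r' s' = 1"
      using g assms by (simp add: eq gcd_mult_distrib_int[symmetric])
    moreover have "0 < s'" "s' < r'"
      using rs assms by (auto simp: eq zero_less_mult_iff)
    moreover have "r' \<le> int (n div d)"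
    proof -
      have "r' = r div int d" using assms by (simp add: eq)
      also have "\<dots> \<le> int n div int d" using rs assms by (intro zdiv_mono1) auto
      finally show ?thesis by (simp add: zdiv_int)
    qed
    ultimately show "(fst (r, s) div int d, snd (r, s) div int d) \<in> P_set (real (n div d))"
      using assms by (auto simp: P_set_of_nat pairs_upto_def eq)
  qed
qed

text \<open>
  A pair with odd gcd \<open>d\<close> is \<open>d\<close> times a coprime pair, and has the same weight; every other pair is
  doubly even. The term \<open>d = 1\<close> stands apart because the sum is used to solve for it.
\<close>

lemma sum_pairs_upto_by_odd_gcd:
  fixes w :: "int \<Rightarrow> int \<Rightarrow> real"
  assumes scale: "\<And>d r s. odd d \<Longrightarrow> w (d * r) (d * s) = w r s"
    and even: "\<And>r s. even r \<Longrightarrow> even s \<Longrightarrow> w r s = 0"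
  shows "(\<Sum>(r,s)\<in>pairs_upto n. w r s) =
           (\<Sum>(r,s)\<in>P_set (real n). w r s)
           + (\<Sum>d\<in>odds_upto n. \<Sum>(r,s)\<in>P_set (real (n div d)). w r s)"
proof (cases "n = 0")
  case True
  then have "pairs_upto n = {}" "P_set (real n) = {}" "odds_upto n = {}"
    by (auto simp: pairs_upto_def P_set_def odds_upto_def)
  then show ?thesis by simp
next
  case False
  let ?D = "insert 1 (odds_upto n)"
  let ?T = "{p \<in> pairs_upto n. odd (gcd (fst p) (snd p))}"
  let ?g = "\<lambda>p. nat (gcd (fst p) (snd p))"
  have sub: "?g ` ?T \<subseteq> ?D"
  proof clarify
    fix r s assume T: "(r, s) \<in> pairs_upto n" and o: "odd (gcd (fst (r, s)) (snd (r, s)))"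
      and "?g (r, s) \<notin> odds_upto n"
    from T have rs: "0 < s" "s < r" "r \<le> int n" by (auto simp: pairs_upto_def)
    then have le: "gcd r s \<le> int n" using zdvd_imp_le[OF gcd_dvd2[of r s]] by linarith
    have pos: "0 < gcd r s" using rs by simp
    have "odd (nat (gcd r s))" using o pos by (simp add: even_nat_iff)
    then show "?g (r, s) = 1"
      using \<open>?g (r, s) \<notin> odds_upto n\<close> le pos by (auto simp: odds_upto_def elim!: oddE)
  qed
  have "(\<Sum>(r,s)\<in>pairs_upto n. w r s) = (\<Sum>(r,s)\<in>?T. w r s)"
    by (rule sum.mono_neutral_right) (auto simp: finite_pairs_upto intro!: even)
  also have "\<dots> = (\<Sum>d\<in>?D. \<Sum>(r,s)\<in>{p\<in>?T. ?g p = d}. w r s)"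
    using sub by (intro sum.group[symmetric]) (auto simp: finite_pairs_upto finite_odds_upto)
  also have "\<dots> = (\<Sum>d\<in>?D. \<Sum>(r,s)\<in>P_set (real (n div d)). w r s)"
  proof (rule sum.cong[OF refl])
    fix d assume "d \<in> ?D"
    then have d: "odd d" "0 < d" by (auto simp: odds_upto_def)
    have "{p\<in>?T. ?g p = d} = {p \<in> pairs_upto n. gcd (fst p) (snd p) = int d}"
      using d by (auto, metis even_of_nat gcd_greatest)
    then have "(\<Sum>(r,s)\<in>{p\<in>?T. ?g p = d}. w r s)
        = (\<Sum>(r,s)\<in>{p \<in> pairs_upto n. gcd (fst p) (snd p) = int d}. w r s)" by simp
    also have "\<dots> = (\<Sum>p\<in>P_set (real (n div d)). w (int d * fst p) (int d * snd p))"
      using sum.reindex_bij_betw[OF bij_betw_scale_P_set[OF d(2)], of "\<lambda>(r,s). w r s"]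
      by simp
    also have "\<dots> = (\<Sum>(r,s)\<in>P_set (real (n div d)). w r s)"
      using d by (simp add: scale case_prod_unfold)
    finally show "(\<Sum>(r,s)\<in>{p\<in>?T. ?g p = d}. w r s) = (\<Sum>(r,s)\<in>P_set (real (n div d)). w r s)" .
  qed
  also have "\<dots> = (\<Sum>(r,s)\<in>P_set (real n). w r s)
           + (\<Sum>d\<in>odds_upto n. \<Sum>(r,s)\<in>P_set (real (n div d)). w r s)"
    by (subst sum.insert) (auto simp: finite_odds_upto, simp add: odds_upto_def)
  finally show ?thesis .
qed

section \<open>Sums over odd dilations\<close>

lemma sum_odds_upto_telescope:
  fixes g :: "nat \<Rightarrow> real"
  assumes step: "\<And>d. odd d \<Longrightarrow> 3 \<le> d \<Longrightarrow> f d \<le> g (d - 1) - g (d + 1)"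
    and nonneg: "\<And>d. 0 \<le> g d"
  shows "sum f (odds_upto n) \<le> g 2"
proof -
  \<comment> \<open>For \<open>n \<ge> 2\<close>, the even number \<open>2 * ((n + 1) div 2)\<close> is one more than the last odd
    number up to \<open>n\<close>, so it is where the telescoping sum ends.\<close>
  have "sum f (odds_upto n) \<le> g 2 - (if n < 2 then g 2 else g (2 * ((n + 1) div 2)))"
  proof (induction n)
    case 0
    have "odds_upto 0 = {}" by (auto simp: odds_upto_def)
    then show ?case by simp
  next
    case (Suc n)
    show ?case
    proof (cases "odd (Suc n) \<and> 3 \<le> Suc n")
      case True
      then have eq: "odds_upto (Suc n) = insert (Suc n) (odds_upto n)"
        by (auto simp: odds_upto_def le_Suc_eq)
      have "sum f (odds_upto (Suc n)) = f (Suc n) + sum f (odds_upto n)"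
        unfolding eq by (subst sum.insert) (auto simp: finite_odds_upto, simp add: odds_upto_def)
      moreover have "f (Suc n) \<le> g n - g (n + 2)"
        using step[of "Suc n"] True by simp
      moreover have "2 * ((n + 1) div 2) = n" "2 * ((Suc n + 1) div 2) = n + 2"
        using True by (auto elim!: evenE)
      ultimately show ?thesis using Suc.IH True by auto
    next
      case False
      then have eq: "odds_upto (Suc n) = odds_upto n"
        by (auto simp: odds_upto_def le_Suc_eq)
      consider "n = 0" | "n = 1" | "odd n" "n \<ge> 2"
        using False by (cases "n \<le> 1") (auto simp: le_Suc_eq)
      then show ?thesis
      proof cases
        case 3
        then have "2 * ((n + 1) div 2) = 2 * ((Suc n + 1) div 2)" by (auto elim!: oddE)
        then show ?thesis using Suc.IH 3 eq by simp
      qed (use eq Suc.IH in auto)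
    qed
  qed
  then show ?thesis using nonneg[of 2] nonneg[of "2 * ((n + 1) div 2)"] by (auto split: if_splits)
qed

lemma sum_odds_inverse_square: "(\<Sum>d\<in>odds_upto n. 1 / (real d)\<^sup>2) \<le> 1 / 4"
proof -
  have "(\<Sum>d\<in>odds_upto n. 1 / (real d)\<^sup>2) \<le> 1 / (2 * real 2)"
  proof (rule sum_odds_upto_telescope)
    fix d :: nat assume d: "3 \<le> d"
    have "(real d - 1) * (real d + 1) \<le> (real d)\<^sup>2"
      by (simp add: algebra_simps power2_eq_square)
    then have "1 / (real d)\<^sup>2 \<le> 1 / ((real d - 1) * (real d + 1))"
      using d by (intro divide_left_mono mult_pos_pos) auto
    also have "\<dots> = 1 / (2 * real (d - 1)) - 1 / (2 * real (d + 1))"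
      using d by (simp add: of_nat_diff divide_simps) (simp add: algebra_simps)
    finally show "1 / (real d)\<^sup>2 \<le> 1 / (2 * real (d - 1)) - 1 / (2 * real (d + 1))" .
  qed simp
  then show ?thesis by simp
qed

text \<open>
  By convexity \<open>d powr (-3/2)\<close> is at most half its integral over \<open>[d - 1, d + 1]\<close>, and these
  intervals tile \<open>[2, \<infinity>)\<close>. That the resulting bound \<open>1 / sqrt 2\<close> is below \<open>1\<close> is what makes the
  induction below close.
\<close>

lemma sum_odds_inverse_powr_three_halves:
  "(\<Sum>d\<in>odds_upto n. 1 / (real d * sqrt (real d))) \<le> 1 / sqrt 2"
proof -
  have "(\<Sum>d\<in>odds_upto n. 1 / (real d * sqrt (real d))) \<le> 1 / sqrt (real 2)"
  proof (rule sum_odds_upto_telescope)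
    fix d :: nat assume d: "3 \<le> d"
    define u v where "u = sqrt (real d - 1)" and "v = sqrt (real d + 1)"
    have uv: "0 < u" "0 < v" "u\<^sup>2 = real d - 1" "v\<^sup>2 = real d + 1"
      using d by (auto simp: u_def v_def)
    have "(u * v)\<^sup>2 \<le> (real d)\<^sup>2"
      by (simp add: power_mult_distrib uv) (simp add: algebra_simps power2_eq_square)
    then have prod: "u * v \<le> real d" by (rule power2_le_imp_le) simp
    have "(u + v)\<^sup>2 \<le> (2 * sqrt (real d))\<^sup>2"
      using prod by (simp add: power2_sum uv power_mult_distrib)
    then have "u + v \<le> 2 * sqrt (real d)" by (rule power2_le_imp_le) simp
    then have "(u * v) * (u + v) \<le> real d * (2 * sqrt (real d))"
      using prod uv by (intro mult_mono) auto
    then have "2 / (real d * (2 * sqrt (real d))) \<le> 2 / ((u * v) * (u + v))"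
      using uv d by (intro divide_left_mono mult_pos_pos) auto
    also have "\<dots> = (v\<^sup>2 - u\<^sup>2) / ((u * v) * (u + v))"
      by (simp add: uv)
    also have "\<dots> = 1 / u - 1 / v"
      using uv(1,2) by (simp add: divide_simps) (simp add: algebra_simps power2_eq_square)
    finally show "1 / (real d * sqrt (real d)) \<le> 1 / sqrt (real (d - 1)) - 1 / sqrt (real (d + 1))"
      using d by (simp add: u_def v_def of_nat_diff add.commute)
  qed simp
  then show ?thesis by simp
qed

text \<open>
  If the bound with constant \<open>4 * C\<close> holds below \<open>n\<close>, the sum over \<open>d \<ge> 3\<close> costs at most
  \<open>4 * C / sqrt 2 \<le> 3 * C\<close>, which leaves room for the \<open>C\<close> of the hypothesis. An exponent above \<open>1\<close>
  is needed for a convergent sum, one below \<open>2\<close> for a gain over the number of pairs.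
\<close>

lemma odd_dilation_bound:
  fixes f :: "nat \<Rightarrow> real"
  assumes bound: "\<And>n. \<bar>f n + (\<Sum>d\<in>odds_upto n. f (n div d))\<bar> \<le> C * (real n * sqrt (real n))"
    and C: "0 \<le> C"
  shows "\<bar>f n\<bar> \<le> 4 * C * (real n * sqrt (real n))"
proof (induction n rule: less_induct)
  case (less n)
  let ?h = "\<lambda>x::real. x * sqrt x"
  have term_bound: "\<bar>f (n div d)\<bar> \<le> 4 * C * ?h (real n) * (1 / ?h (real d))"
    if d: "d \<in> odds_upto n" for d
  proof -
    have "n div d < n" using d by (intro div_less_dividend) (auto simp: odds_upto_def)
    then have "\<bar>f (n div d)\<bar> \<le> 4 * C * ?h (real (n div d))" by (rule less)
    also have "\<dots> \<le> 4 * C * ?h (real n / real d)"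
      using C by (intro mult_mono mult_left_mono mult_nonneg_nonneg real_sqrt_le_mono)
        (auto simp: of_nat_div_le_of_nat)
    also have "\<dots> = 4 * C * ?h (real n) * (1 / ?h (real d))"
      by (simp add: real_sqrt_divide)
    finally show ?thesis .
  qed
  have "\<bar>\<Sum>d\<in>odds_upto n. f (n div d)\<bar> \<le> (\<Sum>d\<in>odds_upto n. 4 * C * ?h (real n) * (1 / ?h (real d)))"
    using term_bound by (intro sum_abs[THEN order_trans] sum_mono)
  also have "\<dots> = 4 * C * ?h (real n) * (\<Sum>d\<in>odds_upto n. 1 / ?h (real d))"
    by (rule sum_distrib_left[symmetric])
  also have "\<dots> \<le> 4 * C * ?h (real n) * (3 / 4)"
  proof -
    have "4 / 3 \<le> sqrt 2" by (rule real_le_rsqrt) (simp add: power2_eq_square)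
    then have "1 / sqrt 2 \<le> 3 / 4" by (simp add: field_simps)
    then show ?thesis
      using sum_odds_inverse_powr_three_halves[of n] C by (intro mult_left_mono) auto
  qed
  finally have "\<bar>\<Sum>d\<in>odds_upto n. f (n div d)\<bar> \<le> 3 * (C * ?h (real n))" by simp
  with bound[of n] show ?case by linarith
qed

section \<open>Weights of all pairs\<close>

text \<open>The excess of opposite-parity pairs over twice the doubly odd ones.\<close>

definition parity_defect :: "int \<Rightarrow> int \<Rightarrow> real" where
  "parity_defect r s = (if odd r \<and> odd s then - 2 else if even r \<and> even s then 0 else 1)"

definition not_both_even :: "int \<Rightarrow> int \<Rightarrow> real" where
  "not_both_even r s = (if even r \<and> even s then 0 else 1)"

lemma sum_pairs_upto_0: "(\<Sum>(r,s)\<in>pairs_upto 0. w r s) = (0::real)"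
  by (rule sum.neutral) (auto simp: pairs_upto_def)

lemma sum_pairs_upto_Suc:
  fixes w :: "int \<Rightarrow> int \<Rightarrow> real"
  shows "(\<Sum>(r,s)\<in>pairs_upto (Suc n). w r s) =
           (\<Sum>(r,s)\<in>pairs_upto n. w r s) + (\<Sum>s=1..n. w (int n + 1) (int s))"
proof -
  let ?row = "(\<lambda>s. (int n + 1, int s)) ` {1..n}"
  have eq: "pairs_upto (Suc n) = pairs_upto n \<union> ?row"
  proof (rule Set.set_eqI)
    fix p :: "int \<times> int"
    obtain r s where p: "p = (r, s)" by (cases p)
    have "((r, s) \<in> pairs_upto (Suc n)) = ((r, s) \<in> pairs_upto n \<union> ?row)"
      by (auto simp: pairs_upto_def image_iff intro!: bexI[of _ "nat s"])
    then show "(p \<in> pairs_upto (Suc n)) = (p \<in> pairs_upto n \<union> ?row)"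
      by (simp only: p)
  qed
  have "(\<Sum>(r,s)\<in>pairs_upto (Suc n). w r s) = (\<Sum>(r,s)\<in>pairs_upto n. w r s) + (\<Sum>(r,s)\<in>?row. w r s)"
    unfolding eq by (rule sum.union_disjoint[OF finite_pairs_upto]) (auto simp: pairs_upto_def)
  also have "(\<Sum>(r,s)\<in>?row. w r s) = (\<Sum>s=1..n. w (int n + 1) (int s))"
    by (subst sum.reindex) (auto simp: inj_on_def)
  finally show ?thesis .
qed

lemma sum_by_parity:
  "(\<Sum>s=1..n. if odd s then a else b) = real ((n + 1) div 2) * a + real (n div 2) * (b::real)"
  by (induction n) (auto simp: algebra_simps elim!: evenE oddE)

text \<open>The rows \<open>r = 2 * j\<close> and \<open>r = 2 * j + 1\<close> contribute \<open>j\<close> and \<open>-j\<close>.\<close>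

lemma sum_parity_defect_pairs_upto:
  "(\<Sum>(r,s)\<in>pairs_upto n. parity_defect r s) = (if even n then real n / 2 else 0)"
proof (induction n)
  case 0
  then show ?case by (simp add: sum_pairs_upto_0)
next
  case (Suc n)
  have "(\<Sum>s=1..n. parity_defect (int n + 1) (int s)) =
          (\<Sum>s=1..n. if odd s then (if even n then - 2 else 1) else (if even n then 1 else 0))"
    by (intro sum.cong refl) (auto simp: parity_defect_def)
  also have "\<dots> = (if even n then - (real n / 2) else (real n + 1) / 2)"
    unfolding sum_by_parity by (auto elim!: evenE oddE)
  finally show ?case using Suc.IH by (auto simp: sum_pairs_upto_Suc)
qed

lemma sum_not_both_even_pairs_upto:
  "real n * (real n - 1) / 4 \<le> (\<Sum>(r,s)\<in>pairs_upto n. not_both_even r s)"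
proof (induction n)
  case 0
  then show ?case by (simp add: sum_pairs_upto_0)
next
  case (Suc n)
  have "(\<Sum>s=1..n. not_both_even (int n + 1) (int s)) =
          (\<Sum>s=1..n. if odd s then 1 else (if even n then 1 else 0))"
    by (intro sum.cong refl) (auto simp: not_both_even_def)
  also have "\<dots> \<ge> real n / 2"
    unfolding sum_by_parity by (auto elim!: evenE oddE)
  finally show ?case using Suc.IH by (simp add: sum_pairs_upto_Suc field_simps)
qed

lemma card_pairs_upto: "real (card (pairs_upto n)) = real n * (real n - 1) / 2"
proof -
  have "(\<Sum>(r,s)\<in>pairs_upto n. 1) = real n * (real n - 1) / 2"
  proof (induction n)
    case (Suc n)
    have "(\<Sum>(r,s)\<in>pairs_upto (Suc n). 1) = (\<Sum>(r,s)\<in>pairs_upto n. 1) + real n"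
      by (simp only: sum_pairs_upto_Suc) simp
    then show ?case unfolding Suc.IH by (simp add: field_simps)
  qed (subst sum_pairs_upto_0, simp)
  then show ?thesis by (simp add: case_prod_unfold)
qed

section \<open>Coprime pairs\<close>

lemma sum_not_both_even_P_set: "(\<Sum>(r,s)\<in>P_set B. not_both_even r s) = real (card (P_set B))"
proof -
  have "(\<Sum>(r,s)\<in>P_set B. not_both_even r s) = (\<Sum>p\<in>P_set B. 1)"
  proof (rule sum.cong[OF refl], clarify)
    fix r s assume "(r, s) \<in> P_set B"
    then have "\<not> (even r \<and> even s)"
      using gcd_greatest[of 2 r s] by (auto simp: P_set_def)
    then show "not_both_even r s = 1" by (auto simp: not_both_even_def)
  qed
  then show ?thesis by simp
qed

lemma sum_parity_defect_P_set:
  "(\<Sum>(r,s)\<in>P_set B. parity_defect r s) = real (card (P_set B)) - 3 * real (card (G1_set B))"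
proof -
  have "(\<Sum>(r,s)\<in>P_set B. parity_defect r s)
      = (\<Sum>(r,s)\<in>P_set B. not_both_even r s - 3 * of_bool (odd r \<and> odd s))"
    by (rule sum.cong) (auto simp: parity_defect_def not_both_even_def)
  also have "\<dots> = real (card (P_set B)) - 3 * (\<Sum>(r,s)\<in>P_set B. of_bool (odd r \<and> odd s))"
    using sum_not_both_even_P_set[of B]
    by (simp add: case_prod_unfold sum_subtractf sum_distrib_left)
  also have "(\<Sum>(r,s)\<in>P_set B. of_bool (odd r \<and> odd s)) = (\<Sum>p\<in>G1_set B. (1::real))"
    by (rule sum.mono_neutral_cong_right[OF finite_P_set])
      (auto simp: P_set_def G1_set_def cong_def odd_iff_mod_2_eq_one)
  finally show ?thesis by simp
qed

text \<open>
  The pairs that are not doubly even number at least about \<open>n\<^sup>2 / 4\<close>; those with an odd gcd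
  \<open>d \<ge> 3\<close> number at most \<open>(n / d)\<^sup>2 / 2\<close> each, hence \<open>n\<^sup>2 / 8\<close> together.
\<close>

lemma card_P_set_lower_bound:
  assumes "4 \<le> n"
  shows "(real n)\<^sup>2 / 16 \<le> real (card (P_set (real n)))"
proof -
  have upper: "real (card (P_set (real (n div d)))) \<le> (real n)\<^sup>2 / 2 * (1 / (real d)\<^sup>2)" for d
  proof -
    have "real (card (P_set (real (n div d)))) \<le> real (card (pairs_upto (n div d)))"
      by (intro of_nat_mono card_mono finite_pairs_upto) (auto simp: P_set_of_nat)
    also have "\<dots> \<le> (real (n div d))\<^sup>2 / 2"
      by (simp add: card_pairs_upto power2_eq_square algebra_simps)
    also have "\<dots> \<le> (real n / real d)\<^sup>2 / 2"
      by (intro divide_right_mono power_mono) (auto simp: of_nat_div_le_of_nat)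
    finally show ?thesis by (simp add: power_divide)
  qed
  have "(\<Sum>d\<in>odds_upto n. real (card (P_set (real (n div d)))))
      \<le> (real n)\<^sup>2 / 2 * (\<Sum>d\<in>odds_upto n. 1 / (real d)\<^sup>2)"
    unfolding sum_distrib_left by (intro sum_mono upper)
  also have "\<dots> \<le> (real n)\<^sup>2 / 2 * (1 / 4)"
    by (intro mult_left_mono sum_odds_inverse_square) simp
  finally have multiples: "(\<Sum>d\<in>odds_upto n. real (card (P_set (real (n div d))))) \<le> (real n)\<^sup>2 / 8"
    by simp
  have "(\<Sum>(r,s)\<in>pairs_upto n. not_both_even r s) = real (card (P_set (real n)))
      + (\<Sum>d\<in>odds_upto n. real (card (P_set (real (n div d)))))"
    unfolding sum_not_both_even_P_set[symmetric]
    by (rule sum_pairs_upto_by_odd_gcd) (auto simp: not_both_even_def)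
  with sum_not_both_even_pairs_upto[of n] multiples
  have "real n * (real n - 1) / 4 - (real n)\<^sup>2 / 8 \<le> real (card (P_set (real n)))" by linarith
  moreover have "4 * real n \<le> real n * real n" using assms by (intro mult_right_mono) auto
  ultimately show ?thesis by (simp add: power2_eq_square field_simps)
qed

lemma card_defect_bound:
  "\<bar>real (card (P_set (real n))) - 3 * real (card (G1_set (real n)))\<bar> \<le> 2 * (real n * sqrt (real n))"
proof -
  let ?D = "\<lambda>n. \<Sum>(r,s)\<in>P_set (real n). parity_defect r s"
  have "\<bar>?D n\<bar> \<le> 4 * (1 / 2) * (real n * sqrt (real n))"
  proof (rule odd_dilation_bound)
    fix n
    have "?D n + (\<Sum>d\<in>odds_upto n. ?D (n div d)) = (\<Sum>(r,s)\<in>pairs_upto n. parity_defect r s)"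
      by (rule sum_pairs_upto_by_odd_gcd[symmetric]) (auto simp: parity_defect_def)
    then have "\<bar>?D n + (\<Sum>d\<in>odds_upto n. ?D (n div d))\<bar> \<le> real n / 2"
      by (simp add: sum_parity_defect_pairs_upto)
    also have "real n \<le> real n * sqrt (real n)"
      by (cases "n = 0") (auto simp: mult_le_cancel_left1)
    finally show "\<bar>?D n + (\<Sum>d\<in>odds_upto n. ?D (n div d))\<bar> \<le> 1 / 2 * (real n * sqrt (real n))"
      by simp
  qed simp
  then show ?thesis by (simp add: sum_parity_defect_P_set)
qed

section \<open>The limit\<close>

lemma ratio_tendsto_nat:
  "(\<lambda>n. real (card (G1_set (real n))) / real (card (P_set (real n)))) \<longlonglongrightarrow> 1 / 3"
proof -
  let ?P = "\<lambda>n. real (card (P_set (real n)))" and ?G = "\<lambda>n. real (card (G1_set (real n)))"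
  have "(\<lambda>n. 1 / 3 - ?G n / ?P n) \<longlonglongrightarrow> 0"
  proof (rule Lim_null_comparison)
    show "(\<lambda>n. 32 / 3 * (1 / sqrt (real n))) \<longlonglongrightarrow> 0"
      by real_asymp
    show "\<forall>\<^sub>F n in sequentially. norm (1 / 3 - ?G n / ?P n) \<le> 32 / 3 * (1 / sqrt (real n))"
      using eventually_ge_at_top[of 4]
    proof eventually_elim
      case (elim n)
      have lower: "(real n)\<^sup>2 / 16 \<le> ?P n" using elim by (rule card_P_set_lower_bound)
      have n: "0 < (real n)\<^sup>2 / 16" using elim by simp
      with lower have P: "0 < ?P n" by linarith
      have "norm (1 / 3 - ?G n / ?P n) = \<bar>(?P n - 3 * ?G n) / (3 * ?P n)\<bar>"
        using P by (simp add: field_simps)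
      also have "\<dots> = \<bar>?P n - 3 * ?G n\<bar> / (3 * ?P n)"
        using P by (simp add: abs_divide)
      also have "\<dots> \<le> (2 * (real n * sqrt (real n))) / (3 * ((real n)\<^sup>2 / 16))"
        using card_defect_bound[of n] lower n by (intro frac_le) auto
      also have "\<dots> = 32 / 3 * (1 / sqrt (real n))"
        using elim by (simp add: field_simps power2_eq_square)
      finally show ?case .
    qed
  qed
  from tendsto_diff[OF tendsto_const[of "1 / 3"] this] show ?thesis by simp
qed

theorem theorem4p7:
  shows "((\<lambda>B :: real. real (card (G1_set B)) / real (card (P_set B))) \<longlongrightarrow> 1 / 3) at_top"
proof -
  have "filterlim (\<lambda>B::real. nat \<lfloor>B\<rfloor>) sequentially at_top"
    by (rule filterlim_compose[OF filterlim_nat_sequentially filterlim_floor_sequentially])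
  from filterlim_compose[OF ratio_tendsto_nat this] show ?thesis
  proof (rule Lim_transform_eventually)
    show "\<forall>\<^sub>F B in at_top. real (card (G1_set (real (nat \<lfloor>B\<rfloor>)))) / real (card (P_set (real (nat \<lfloor>B\<rfloor>))))
            = real (card (G1_set B)) / real (card (P_set B))"
      using eventually_ge_at_top[of 0]
    proof eventually_elim
      case (elim B)
      have "real (nat \<lfloor>B\<rfloor>) = of_int \<lfloor>B\<rfloor>" using elim by simp
      then show ?case by (simp add: P_set_def G1_set_def le_floor_iff)
    qed
  qed
qed

end
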